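(* Let $x\in(0,\pi/2)$, and write $M_k(t;q)=\left(1-\frac k3+\frac k3 t^{q}\right)^{1/(kq)}$ for $t\in(0,1)$. All pairs $(k,q)$ below are assumed to satisfy ($q\le0$ and $k\ge0$) or ($q\ge0$ and $k\le3$). Consider the double inequality \[ M_k(\cos x;q_1)<\frac{\sin x}{x}<M_k(\cos x;q_2). \tag{$*$} \] (i) If $k\in(3,\infty)$, then $\frac{\sin x}{x}>M_k(\cos x;q)$ holds for $\frac{8}{5(3-k)}\le q\le0$. (ii) If $k\in[\frac{35\pi^2-140}{136},3)$, then $( * )$ holds if $q_2\ge\frac{8}{5(3-k)}$ and $q_1\le1$. (iii) If $k\in[\frac{\pi^2}{4}-1,\frac{35\pi^2-140}{136})$, then $( * )$ holds if $q_2\ge\frac{8}{5(3-k)}$ and either $q_1\le\frac{34}{35}$ or $\frac{\pi^2/4-1}{k}\le q_1\le1$. (iv) If $k\in[\frac75,\frac{\pi^2}{4}-1)$, then $( * )$ holds if $q_2\ge\frac{8}{5(3-k)}$ and $q_1\le\frac{34}{35}$. (v) If $k\in[\frac{23}{17},\frac75)$, then $( * )$ holds if $q_2\ge1$ and $q_1\le\frac{34}{35}$. (vi) If $k\in[0,\frac{23}{17})$, then $( * )$ holds if $q_2\ge1$ and $q_1\le\frac{8}{5(3-k)}$. (vii) If $k\in(-\infty,0)$, then $( * )$ holds if $q_2\ge1$ and $0\le q_1\le\frac{8}{5(3-k)}$.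
   Context: Limit conventions: $M_k(t;q)$ means $\exp\frac{t^q-1}{3q}$ when $k=0\ne q$, and $t^{1/3}$ when $q=0$. *)

theory Defs
  imports Complex_Main
begin

text \<open>Power-type mean M_k(t;q) = (1 - k/3 + k/3 t^q)^(1/(kq)), with the limit
conventions: t^(1/3) when q = 0, and exp((t^q - 1)/(3q)) when k = 0, q nonzero.\<close>
definition M :: "real \<Rightarrow> real \<Rightarrow> real \<Rightarrow> real" where
  "M k t q = (if q = 0 then t powr (1/3)
              else if k = 0 then exp ((t powr q - 1) / (3 * q))
              else (1 - k/3 + k/3 * t powr q) powr (1 / (k * q)))"

definition admissible :: "real \<Rightarrow> real \<Rightarrow> bool" where
  "admissible k q \<longleftrightarrow> (q \<le> 0 \<and> 0 \<le> k) \<or> (0 \<le> q \<and> k \<le> 3)"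

definition dbl :: "real \<Rightarrow> real \<Rightarrow> real \<Rightarrow> real \<Rightarrow> bool" where
  "dbl k q1 q2 x \<longleftrightarrow> M k (cos x) q1 < sin x / x \<and> sin x / x < M k (cos x) q2"

end

theory Submission
  imports Defs "HOL-Analysis.Complex_Transcendental"
begin

text \<open>Write \<open>t = cos x\<close>, \<open>u = sin x / x\<close> and let \<open>b p y = (y powr p - 1) / p\<close> with \<open>b 0 = ln\<close>. Uniformly in
  \<open>k\<close> and \<open>q\<close>, the inequality \<open>M k t q < u\<close> means \<open>b q t / 3 < b (k q) u\<close>, and \<open>b p u\<close> increases with \<open>p\<close>.
  On the curve \<open>(3 - k) q = 8 / 5\<close> the quantity \<open>M k t q\<close> is, up to a power, the power mean of exponent
  \<open>15 q / 8 - 1\<close> of a fixed probability measure, hence increasing in \<open>q\<close>. Everything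
  thereby reduces to \<open>u < M (7/5) t 1\<close>, \<open>M (23/17) t (34/35) < u\<close> and \<open>M (36/25) t 1 < u\<close>. For each of
  these, the derivative of \<open>ln u - ln (M k t q)\<close> has the sign of \<open>x - N / D\<close> for a function \<open>N / D\<close> of
  \<open>x\<close> free of \<open>x\<close> outside trigonometric functions, and the derivative of \<open>N / D - x\<close> is an algebraic
  function of \<open>cos x\<close> whose sign can be determined.\<close>

section \<open>Box-Cox transforms and the equation defining \<open>M\<close>\<close>

definition box_cox :: "real \<Rightarrow> real \<Rightarrow> real" where
  "box_cox p y = (if p = 0 then ln y else (y powr p - 1) / p)"

lemma box_cox_one [simp]: "box_cox p 1 = 0"
  by (simp add: box_cox_def)

lemma has_real_derivative_box_cox:
  assumes "0 < y"
  shows "(box_cox p has_real_derivative y powr (p - 1)) (at y)"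
proof (cases "p = 0")
  case True
  have "box_cox p = ln"
    using True by (auto simp: box_cox_def)
  then show ?thesis
    using assms True by (auto simp: powr_minus divide_simps intro!: derivative_eq_intros)
next
  case False
  have "box_cox p = (\<lambda>y. (y powr p - 1) / p)"
    using False by (auto simp: box_cox_def)
  then show ?thesis
    using assms False by (auto intro!: derivative_eq_intros)
qed

lemma DERIV_box_cox [derivative_intros]:
  assumes "(f has_real_derivative f') (at x within A)" and "0 < f x"
  shows "((\<lambda>x. box_cox p (f x)) has_real_derivative f x powr (p - 1) * f') (at x within A)"
  using DERIV_chain2[OF has_real_derivative_box_cox[OF assms(2)] assms(1)] by simp

lemma box_cox_strict_mono:
  assumes "0 < y" and "y < z"
  shows "box_cox p y < box_cox p z"
proof (rule DERIV_pos_imp_increasing[OF assms(2)])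
  fix v assume "y \<le> v" "v \<le> z"
  then have "0 < v"
    using assms by simp
  then show "\<exists>d. (box_cox p has_real_derivative d) (at v) \<and> 0 < d"
    using has_real_derivative_box_cox[of v p] by fastforce
qed

lemma box_cox_less_iff:
  assumes "0 < y" and "0 < z"
  shows "box_cox p y < box_cox p z \<longleftrightarrow> y < z"
  using assms box_cox_strict_mono[of y z p] box_cox_strict_mono[of z y p]
  by (cases y z rule: linorder_cases) auto

text \<open>The difference has derivative \<open>v powr (b - 1) - v powr (a - 1)\<close>, which is
  nonnegative above \<open>1\<close> and nonpositive below, so its minimum is its value
  \<open>0\<close> at \<open>1\<close>.\<close>

lemma box_cox_mono_exponent:
  assumes "a \<le> b" and "0 < y"
  shows "box_cox a y \<le> box_cox b y"
proof -
  define h where "h v = box_cox b v - box_cox a v" for v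
  have h': "(h has_real_derivative v powr (b - 1) - v powr (a - 1)) (at v)" if "0 < v" for v
    unfolding h_def using that by (auto intro!: derivative_eq_intros)
  have "h 1 \<le> h y"
  proof (cases "1 \<le> y")
    case True
    show ?thesis
    proof (rule DERIV_nonneg_imp_nondecreasing[OF True])
      fix v :: real assume "1 \<le> v" "v \<le> y"
      then have "v powr (a - 1) \<le> v powr (b - 1)"
        using assms by (intro powr_mono) auto
      then show "\<exists>d. (h has_real_derivative d) (at v) \<and> 0 \<le> d"
        using h'[of v] \<open>1 \<le> v\<close> by fastforce
    qed
  next
    case False
    show ?thesis
    proof (rule DERIV_nonpos_imp_nonincreasing[of y 1])
      fix v :: real assume v: "y \<le> v" "v \<le> 1"
      then have "v powr (b - 1) \<le> v powr (a - 1)"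
        using assms by (intro powr_mono') auto
      then show "\<exists>d. (h has_real_derivative d) (at v) \<and> d \<le> 0"
        using h'[of v] v assms by fastforce
    qed (use False in simp)
  qed
  then show ?thesis
    by (simp add: h_def)
qed

text \<open>Rescaling by \<open>m\<close> turns a comparison of a mean with \<open>m\<close> into
  the sign of the average of \<open>box_cox p\<close> at rescaled points, where monotonicity in
  \<open>p\<close> applies pointwise.\<close>

lemma box_cox_divide:
  assumes "0 < y" and "0 < m"
  shows "box_cox p (y / m) = m powr (-p) * (box_cox p y - box_cox p m)"
  using assms by (auto simp: box_cox_def ln_div powr_divide powr_minus field_simps)

lemma box_cox_powr:
  assumes "0 < y"
  shows "box_cox p (y powr c) = c * box_cox (c * p) y"
  using assms by (auto simp: box_cox_def ln_powr powr_powr)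

text \<open>Solving this equation for the mean gives the formula for \<open>M\<close>; the case
  \<open>p = 0\<close> of \<open>box_cox\<close> matches the limit conventions. Admissibility keeps
  the base positive: \<open>t powr q\<close> exceeds \<open>1\<close> for \<open>q < 0\<close>,
  where \<open>0 \<le> k\<close>, and lies in \<open>(0, 1)\<close> for \<open>q > 0\<close>, where
  \<open>k \<le> 3\<close>.\<close>

lemma box_cox_M:
  assumes "admissible k q" and "0 < t" and "t < 1"
  shows "0 < M k t q" and "box_cox (k * q) (M k t q) = box_cox q t / 3"
proof -
  have base: "0 < 1 - k / 3 + k / 3 * t powr q" if "q \<noteq> 0"
  proof -
    consider "q < 0" "0 \<le> k" | "0 < q" "k \<le> 3"
      using assms(1) \<open>q \<noteq> 0\<close> by (auto simp: admissible_def)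
    then show ?thesis
    proof cases
      case 1
      then have "1 < t powr q"
        using assms powr_less_mono2_neg[of q t 1] by simp
      then have "k / 3 * 1 \<le> k / 3 * t powr q"
        using 1 by (intro mult_left_mono) auto
      then show ?thesis by simp
    next
      case 2
      then have t: "0 < t powr q" "t powr q < 1"
        using assms powr_less_mono2[of q t 1] by auto
      show ?thesis
      proof (cases "0 < k")
        case True
        have "0 < k / 3 * t powr q"
          using True t by simp
        then show ?thesis
          using 2 by simp
      next
        case False
        then have "k / 3 * 1 \<le> k / 3 * t powr q"
          using t by (intro mult_left_mono_neg) auto
        then show ?thesis by simp
      qed
    qed
  qed
  show "0 < M k t q"
    using base assms by (auto simp: M_def)
  show "box_cox (k * q) (M k t q) = box_cox q t / 3"
    using base assms by (auto simp: M_def box_cox_def powr_powr ln_powr divide_simps)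
      (auto simp: algebra_simps)
qed

lemma M_less_iff_box_cox:
  assumes "admissible k q" and "0 < t" and "t < 1" and "0 < u"
  shows "M k t q < u \<longleftrightarrow> box_cox q t / 3 < box_cox (k * q) u"
  using box_cox_less_iff[OF box_cox_M(1)[OF assms(1-3)] assms(4), of "k * q"]
  unfolding box_cox_M(2)[OF assms(1-3)] by (rule sym)

lemma less_M_iff_box_cox:
  assumes "admissible k q" and "0 < t" and "t < 1" and "0 < u"
  shows "u < M k t q \<longleftrightarrow> box_cox (k * q) u < box_cox q t / 3"
  using box_cox_less_iff[OF assms(4) box_cox_M(1)[OF assms(1-3)], of "k * q"]
  unfolding box_cox_M(2)[OF assms(1-3)] by (rule sym)

section \<open>Monotonicity in the exponent by averaging\<close>

text \<open>Monotonicity of the power mean of the two-point distribution with mass \<open>l\<close> at \<open>t\<close> and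
  mass \<open>1 - l\<close> at \<open>1\<close>.\<close>

lemma two_point_mean_mono:
  assumes "a \<le> b" and "0 \<le> l" "l \<le> 1" and "0 < t" and "0 < m"
    and "l * box_cox b t < box_cox b m"
  shows "l * box_cox a t < box_cox a m"
proof -
  \<comment> \<open>The left side is the average of \<open>box_cox p\<close> over the rescaled
    distribution; the right side shows that its sign decides the claim.\<close>
  have E: "l * box_cox p (t / m) + (1 - l) * box_cox p (1 / m)
      = m powr (-p) * (l * box_cox p t - box_cox p m)" for p
    using assms by (simp add: box_cox_divide algebra_simps)
  have "l * box_cox a (t / m) + (1 - l) * box_cox a (1 / m)
      \<le> l * box_cox b (t / m) + (1 - l) * box_cox b (1 / m)"
    using assms by (intro add_mono mult_left_mono box_cox_mono_exponent) auto
  also have "\<dots> < 0"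
    unfolding E using assms by (intro mult_pos_neg) auto
  finally show ?thesis
    unfolding E using assms by (simp add: mult_less_0_iff)
qed

text \<open>For the probability measure on \<open>[s, 1]\<close> consisting of Lebesgue measure and an atom of mass
  \<open>s\<close> at \<open>s\<close>, integration by parts shows that the mean of \<open>box_cox a\<close> is \<open>box_cox (a + 1) s\<close>.
  The quantity below is therefore the mean of \<open>v \<mapsto> box_cox a (v / m)\<close>.\<close>

lemma truncated_uniform_mean_mono:
  assumes "a \<le> b" and "0 < s" "s \<le> 1" and "0 < m"
  shows "m powr (-a) * (box_cox (a + 1) s - box_cox a m)
       \<le> m powr (-b) * (box_cox (b + 1) s - box_cox b m)"
proof -
  \<comment> \<open>\<open>R p\<close> is an antiderivative of \<open>box_cox p (v / m)\<close>: its
    increment over \<open>[s, 1]\<close> is the Lebesgue part of the mean, to which the atom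
    contributes \<open>s * box_cox p (s / m)\<close>.\<close>
  define R where "R p v = v * box_cox p (v / m) - m * box_cox (p + 1) (v / m)" for p v
  have R': "(R p has_real_derivative box_cox p (v / m)) (at v)" if "0 < v" for p v
  proof -
    have "v * ((v / m) powr (p - 1) / m) = (v / m) powr p"
      using that assms by (simp add: powr_diff)
    then have "box_cox p (v / m) + v * ((v / m) powr (p - 1) / m) - m * ((v / m) powr p / m)
        = box_cox p (v / m)"
      using assms by simp
    moreover have "(R p has_real_derivative
        box_cox p (v / m) + v * ((v / m) powr (p - 1) / m) - m * ((v / m) powr p / m)) (at v)"
      unfolding R_def using that assms by (auto intro!: derivative_eq_intros)
    ultimately show ?thesis
      by simp
  qed
  have "R b s - R a s \<le> R b 1 - R a 1"
  proof (rule DERIV_nonneg_imp_nondecreasing[OF assms(3), of "\<lambda>v. R b v - R a v"])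
    fix v assume "s \<le> v" "v \<le> 1"
    then have v: "0 < v"
      using assms by simp
    have "box_cox a (v / m) \<le> box_cox b (v / m)"
      using v assms by (intro box_cox_mono_exponent) auto
    then show "\<exists>d. ((\<lambda>v. R b v - R a v) has_real_derivative d) (at v) \<and> 0 \<le> d"
      using DERIV_diff[OF R'[OF v, of b] R'[OF v, of a]] by fastforce
  qed
  moreover have "s * box_cox a (s / m) \<le> s * box_cox b (s / m)"
    using assms by (intro mult_left_mono box_cox_mono_exponent) auto
  moreover have "s * box_cox p (s / m) + (R p 1 - R p s)
      = m powr (-p) * (box_cox (p + 1) s - box_cox p m)" for p
  proof -
    have "m * m powr (- (p + 1)) = m powr (-p)"
      using assms by (simp add: powr_diff powr_minus)
    then show ?thesis
      using assms by (simp add: R_def box_cox_divide algebra_simps)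
  qed
  ultimately show ?thesis
    by (smt (verit))
qed

text \<open>The curve \<open>(3 - k) q = 8 / 5\<close> on which the expansions of the two sides at \<open>x = 0\<close> agree
  up to fourth order is the line of exponents \<open>k q = 3 q - 8 / 5\<close>.\<close>

lemma box_cox_curve:
  assumes "0 < t" and "0 < u"
  shows "box_cox (15 * q / 8 - 1 + 1) (t powr (8 / 15)) - box_cox (15 * q / 8 - 1) (u powr (8 / 5))
       = 8 / 5 * (box_cox q t / 3 - box_cox (3 * q - 8 / 5) u)"
  using assms by (simp add: box_cox_powr algebra_simps)

text \<open>With \<open>s = t powr (8 / 15)\<close> and \<open>m = u powr (8 / 5)\<close>, the
  defect \<open>e q\<close> times the positive weight \<open>c q\<close> is nondecreasing in
  \<open>q\<close>. Negative defects thus persist for smaller exponents, positive ones for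
  larger.\<close>

lemma curve_mean_mono:
  assumes "q \<le> r" and "0 < t" "t \<le> 1" and "0 < u"
  shows curve_mean_mono_lower:
      "box_cox r t / 3 < box_cox (3 * r - 8 / 5) u \<Longrightarrow> box_cox q t / 3 < box_cox (3 * q - 8 / 5) u"
    and curve_mean_mono_upper:
      "box_cox (3 * q - 8 / 5) u < box_cox q t / 3 \<Longrightarrow> box_cox (3 * r - 8 / 5) u < box_cox r t / 3"
proof -
  define m where "m = u powr (8 / 5)"
  have m: "0 < m"
    using assms by (simp add: m_def)
  have s: "0 < t powr (8 / 15)" "t powr (8 / 15) \<le> 1"
    using assms powr_mono2[of "8 / 15" t 1] by auto
  define e where "e q = box_cox q t / 3 - box_cox (3 * q - 8 / 5) u" for q
  define c where "c q = m powr (- (15 * q / 8 - 1))" for q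
  have c: "0 < c q" for q
    using m by (simp add: c_def)
  have "c q * (8 / 5 * e q) \<le> c r * (8 / 5 * e r)"
    using truncated_uniform_mean_mono[of "15 * q / 8 - 1" "15 * r / 8 - 1" "t powr (8 / 15)" m]
      assms s m
    unfolding e_def c_def box_cox_curve[OF assms(2,4), symmetric] m_def by simp
  then have le: "c q * e q \<le> c r * e r"
    by simp
  have "e q < 0" if "e r < 0"
    using le mult_pos_neg[OF c that, of r] c[of q]
    by (smt (verit) mult_nonneg_nonneg)
  then show "box_cox r t / 3 < box_cox (3 * r - 8 / 5) u \<Longrightarrow> box_cox q t / 3 < box_cox (3 * q - 8 / 5) u"
    by (simp add: e_def)
  have "0 < e r" if "0 < e q"
    using le mult_pos_pos[OF c that, of q] c[of r]
    by (smt (verit) mult_nonneg_nonpos)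
  then show "box_cox (3 * q - 8 / 5) u < box_cox q t / 3 \<Longrightarrow> box_cox (3 * r - 8 / 5) u < box_cox r t / 3"
    by (simp add: e_def)
qed

section \<open>Comparing \<open>sin x / x\<close> with \<open>M\<close> through derivatives\<close>

text \<open>A right-hand limit replaces the value at \<open>0\<close>, where
  \<open>sin x / x\<close> is \<open>0\<close> by the convention for division. Passing through
  \<open>x / 2\<close> keeps the inequality strict.\<close>

lemma pos_of_tendsto_0_of_deriv_pos:
  fixes f :: "real \<Rightarrow> real"
  assumes lim: "(f \<longlongrightarrow> 0) (at_right 0)" and "0 < x"
    and der: "\<And>y. 0 < y \<Longrightarrow> y \<le> x \<Longrightarrow> \<exists>d. (f has_real_derivative d) (at y) \<and> 0 < d"
  shows "0 < f x"
proof -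
  have mono: "f y < f z" if "0 < y" "y < z" "z \<le> x" for y z
  proof (rule DERIV_pos_imp_increasing[OF that(2)])
    fix v assume "y \<le> v" "v \<le> z"
    then show "\<exists>d. (f has_real_derivative d) (at v) \<and> 0 < d"
      using that by (intro der) auto
  qed
  have "0 \<le> f (x / 2)"
  proof (rule tendsto_upperbound[OF lim])
    show "\<forall>\<^sub>F y in at_right 0. f y \<le> f (x / 2)"
      unfolding eventually_at_right_field
    proof (intro exI[of _ "x / 2"] conjI allI impI)
      fix y assume "0 < y" "y < x / 2"
      then show "f y \<le> f (x / 2)"
        using mono[of y "x / 2"] by simp
    qed (use \<open>0 < x\<close> in simp)
  qed simp
  also have "\<dots> < f x"
    using mono \<open>0 < x\<close> by simp
  finally show ?thesis .
qed

lemma sinc_tendsto_1: "((\<lambda>x::real. sin x / x) \<longlongrightarrow> 1) (at_right 0)"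
proof -
  have "((\<lambda>x::real. sin x / x) \<longlongrightarrow> 1) (at 0)"
    using DERIV_sin[of "0::real"] by (simp add: DERIV_def)
  then show ?thesis
    by (rule filterlim_mono) (auto simp: at_le)
qed

text \<open>The quotient \<open>barrier\<close> of these two functions is the value that \<open>x\<close> must have for the derivative of
  \<open>ln (sin x / x) - ln (M k (cos x) q)\<close> to vanish.\<close>

definition barrier_num :: "real \<Rightarrow> real \<Rightarrow> real \<Rightarrow> real" where
  "barrier_num k q c = (3 - k) * c powr (1 - q) + k * c"

definition barrier_den :: "real \<Rightarrow> real \<Rightarrow> real \<Rightarrow> real" where
  "barrier_den k q c = 1 + (3 - k) * c * c powr (1 - q) + (k - 1) * c\<^sup>2"

definition barrier :: "real \<Rightarrow> real \<Rightarrow> real \<Rightarrow> real" where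
  "barrier k q x = sin x * barrier_num k q (cos x) / barrier_den k q (cos x)"

text \<open>Up to the factor \<open>(sin x)\<^sup>2 / (barrier_den k q (cos x))\<^sup>2\<close>,
  this is the derivative of \<open>barrier k q x - x\<close> at \<open>c = cos x\<close>.\<close>

definition barrier_sign :: "real \<Rightarrow> real \<Rightarrow> real \<Rightarrow> real" where
  "barrier_sign k q c =
     (let w = c powr (1 - q) in
        (3 - k)\<^sup>2 * w\<^sup>2 + (3 - k) * w * ((2 * k - 2 - q) * c - (1 - q) / c)
        + (k - 1)\<^sup>2 * c\<^sup>2 - (k + 1))"

lemma barrier_num_pos:
  assumes "1 \<le> k" "k < 3" "0 < c"
  shows "0 < barrier_num k q c"
  using assms unfolding barrier_num_def by (intro add_pos_pos mult_pos_pos) simp_all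

lemma barrier_den_pos:
  assumes "1 \<le> k" "k < 3" "0 < c"
  shows "0 < barrier_den k q c"
  using assms unfolding barrier_den_def by (intro add_pos_nonneg mult_nonneg_nonneg) simp_all

text \<open>The left side is the numerator from the quotient rule for \<open>s * n / d\<close>,
  minus \<open>d\<^sup>2\<close>; \<open>w'\<close> is the derivative of
  \<open>w = c powr (1 - q)\<close> along \<open>c = cos x\<close>.\<close>

lemma barrier_algebra:
  fixes k q c w s :: real
  assumes "c \<noteq> 0" and "s\<^sup>2 = 1 - c\<^sup>2"
  defines "w' \<equiv> - (1 - q) * s * w / c"
  defines "n \<equiv> (3 - k) * w + k * c" and "d \<equiv> 1 + (3 - k) * c * w + (k - 1) * c\<^sup>2"
  shows "(c * n + s * ((3 - k) * w' - k * s)) * d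
       - s * n * ((3 - k) * (c * w' - s * w) - 2 * (k - 1) * c * s) - d\<^sup>2
       = (1 - c\<^sup>2) * ((3 - k)\<^sup>2 * w\<^sup>2 + (3 - k) * w * ((2 * k - 2 - q) * c - (1 - q) / c)
          + (k - 1)\<^sup>2 * c\<^sup>2 - (k + 1))"
proof -
  \<comment> \<open>Writing \<open>w = v * c\<close> removes the divisions by \<open>c\<close>,
    leaving a polynomial identity modulo \<open>s\<^sup>2 = 1 - c\<^sup>2\<close>.\<close>
  define v where "v = w / c"
  have w: "w = v * c" and w': "w' = - (1 - q) * s * v"
    using assms by (auto simp: v_def)
  have *: "(3 - k) * (v * c) * ((2 * k - 2 - q) * c - (1 - q) / c)
      = (3 - k) * v * ((2 * k - 2 - q) * c\<^sup>2 - (1 - q))"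
    using assms(1) by (simp add: field_simps power2_eq_square)
  show ?thesis
    unfolding n_def d_def w' w * using assms(2) by algebra
qed

lemma barrier_deriv:
  assumes "1 \<le> k" "k < 3" "0 < cos x"
  shows "((\<lambda>x. barrier k q x - x) has_real_derivative
      (1 - (cos x)\<^sup>2) * barrier_sign k q (cos x) / (barrier_den k q (cos x))\<^sup>2) (at x)"
proof -
  define c s w where "c = cos x" and "s = sin x" and "w = c powr (1 - q)"
  define w' where "w' = - (1 - q) * s * w / c"
  define n where "n = (3 - k) * w + k * c"
  define d where "d = 1 + (3 - k) * c * w + (k - 1) * c\<^sup>2"
  have c: "0 < c"
    using assms by (simp add: c_def)
  have d: "0 < d" and d_eq: "d = barrier_den k q (cos x)"
    using barrier_den_pos[OF assms] by (simp_all add: barrier_den_def d_def c_def w_def)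
  have dw: "((\<lambda>x. cos x powr (1 - q)) has_real_derivative w') (at x)"
  proof (rule DERIV_cong[OF DERIV_chain2[OF has_real_derivative_powr[OF assms(3)] DERIV_cos]])
    have "c powr (1 - q - 1) = w / c"
      using c powr_diff[of c "1 - q" 1] by (simp add: w_def)
    then show "(1 - q) * cos x powr (1 - q - 1) * - sin x = w'"
      by (simp add: w'_def c_def s_def algebra_simps)
  qed
  have "(barrier k q has_real_derivative
      ((c * n + s * ((3 - k) * w' - k * s)) * d
       - s * n * ((3 - k) * (c * w' - s * w) - 2 * (k - 1) * c * s)) / d\<^sup>2) (at x)"
    unfolding barrier_def[abs_def] barrier_num_def barrier_den_def
    by (rule derivative_eq_intros dw refl | use d in \<open>simp add: d_def c_def w_def; fail\<close>)+
      (simp add: n_def d_def c_def s_def w_def power2_eq_square algebra_simps)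
  then have "((\<lambda>x. barrier k q x - x) has_real_derivative
      ((c * n + s * ((3 - k) * w' - k * s)) * d
       - s * n * ((3 - k) * (c * w' - s * w) - 2 * (k - 1) * c * s)) / d\<^sup>2 - 1) (at x)"
    by (intro DERIV_diff DERIV_ident)
  moreover have "((c * n + s * ((3 - k) * w' - k * s)) * d
       - s * n * ((3 - k) * (c * w' - s * w) - 2 * (k - 1) * c * s)) / d\<^sup>2 - 1
       = (1 - c\<^sup>2) * barrier_sign k q c / d\<^sup>2"
  proof -
    have "s\<^sup>2 = 1 - c\<^sup>2"
      by (simp add: s_def c_def sin_squared_eq)
    with c have "(c * n + s * ((3 - k) * w' - k * s)) * d
        - s * n * ((3 - k) * (c * w' - s * w) - 2 * (k - 1) * c * s) - d\<^sup>2
        = (1 - c\<^sup>2) * barrier_sign k q c"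
      unfolding barrier_sign_def Let_def w_def[symmetric] n_def d_def w'_def
      by (intro barrier_algebra) auto
    then show ?thesis
      using d by (simp add: diff_divide_eq_iff divide_diff_eq_iff)
  qed
  ultimately show ?thesis
    by (simp add: c_def d_eq)
qed

lemma ln_sinc_minus_ln_M_deriv:
  assumes "1 \<le> k" "k < 3" "0 < q" "0 < x" "x < pi / 2"
  shows "((\<lambda>x. ln (sin x / x) - ln (M k (cos x) q)) has_real_derivative
      barrier_den k q (cos x) * (x - barrier k q x)
        / (x * sin x * barrier_num k q (cos x))) (at x)"
proof -
  define c s w where "c = cos x" and "s = sin x" and "w = c powr (1 - q)"
  define b where "b = 1 - k / 3 + k / 3 * c powr q"
  have c: "0 < c" and s: "0 < s"
    using assms by (auto simp: c_def s_def intro: cos_gt_zero sin_gt_zero)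
  have w: "0 < w"
    using c by (simp add: w_def)
  have cq: "c powr q = c / w"
    using c by (simp add: w_def powr_diff)
  have b: "0 < b"
    using assms c by (auto simp: b_def intro!: add_pos_pos)
  \<comment> \<open>Up to the factor \<open>3 * w\<close>, the numerator is the base
    \<open>b\<close> of the mean; this is how it enters the logarithmic derivative of
    \<open>M\<close>.\<close>
  have n: "barrier_num k q c = 3 * w * b"
    using w by (simp add: barrier_num_def b_def cq w_def[symmetric] field_simps)
  have dM: "((\<lambda>x. ln (M k (cos x) q)) has_real_derivative - (s / (3 * w * b))) (at x)"
  proof -
    have "((\<lambda>x. cos x powr q) has_real_derivative - (q * s / w)) (at x)"
      using DERIV_chain2[OF has_real_derivative_powr[of "cos x" q] DERIV_cos] c cq
      by (simp add: c_def s_def powr_diff)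
    then have "((\<lambda>x. ln (1 - k / 3 + k / 3 * cos x powr q) / (k * q)) has_real_derivative
        inverse b * (k / 3 * - (q * s / w)) / (k * q)) (at x)"
      using b unfolding b_def c_def
      by (intro DERIV_cdivide DERIV_chain2[OF DERIV_ln])
        (auto intro!: DERIV_cmult DERIV_add[OF DERIV_const, THEN DERIV_cong]
          simp del: times_divide_eq_left)
    then have "((\<lambda>x. ln (1 - k / 3 + k / 3 * cos x powr q) / (k * q)) has_real_derivative
        - (s / (3 * w * b))) (at x)"
      using assms b w by (simp add: field_simps)
    moreover have "\<forall>\<^sub>F y in nhds x. 0 < cos y"
      using c unfolding c_def
      by (intro order_tendstoD(1)[OF isCont_tendsto_compose[OF _ filterlim_ident]]) auto
    then have "\<forall>\<^sub>F y in nhds x. ln (M k (cos y) q)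
        = ln (1 - k / 3 + k / 3 * cos y powr q) / (k * q)"
    proof eventually_elim
      case (elim y)
      have "0 < 1 - k / 3 + k / 3 * cos y powr q"
        using assms elim by (intro add_pos_nonneg) auto
      then show ?case
        using assms by (simp add: M_def ln_powr)
    qed
    ultimately show ?thesis
      by (subst DERIV_cong_ev[OF refl _ refl])
  qed
  have "((\<lambda>x. ln (sin x / x)) has_real_derivative c / s - 1 / x) (at x)"
    using assms s by (auto intro!: derivative_eq_intros simp: c_def s_def field_simps)
  from DERIV_diff[OF this dM]
  have "((\<lambda>x. ln (sin x / x) - ln (M k (cos x) q)) has_real_derivative
      c / s - 1 / x + s / (3 * w * b)) (at x)"
    by simp
  moreover have "barrier_den k q c = c * (3 * w * b) + s\<^sup>2"
    unfolding n[symmetric] by (simp add: barrier_num_def barrier_den_def s_def c_def sin_squared_eq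
        algebra_simps power2_eq_square)
  then have "c / s - 1 / x + s / (3 * w * b)
      = (barrier_den k q c * x - s * (3 * w * b)) / (x * s * (3 * w * b))"
    using s w b assms by (simp add: field_simps power2_eq_square)
  moreover have "barrier_den k q c * barrier k q x = s * (3 * w * b)"
    using barrier_den_pos[of k c q] assms c n by (simp add: barrier_def c_def s_def)
  ultimately show ?thesis
    by (simp add: n c_def[symmetric] s_def[symmetric] right_diff_distrib)
qed

lemma ln_sinc_minus_ln_M_tendsto_0:
  assumes "0 < k" "0 < q"
  shows "((\<lambda>x. ln (sin x / x) - ln (M k (cos x) q)) \<longlongrightarrow> 0) (at_right 0)"
proof -
  have "((\<lambda>x. ln (sin x / x) - ln ((1 - k / 3 + k / 3 * cos x powr q) powr (1 / (k * q))))
      \<longlongrightarrow> ln 1 - ln ((1 - k / 3 + k / 3 * cos 0 powr q) powr (1 / (k * q)))) (at_right 0)"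
    using assms by (intro tendsto_intros sinc_tendsto_1) auto
  then show ?thesis
    using assms by (simp add: M_def)
qed

lemma barrier_tendsto_0:
  assumes "1 \<le> k" "k < 3"
  shows "((\<lambda>x. barrier k q x - x) \<longlongrightarrow> 0) (at_right 0)"
proof -
  have "((\<lambda>x. barrier k q x - x) \<longlongrightarrow> barrier k q 0 - 0) (at 0)"
    using DERIV_isCont[OF barrier_deriv[OF assms, of 0 q]] by (simp add: isCont_def)
  then show ?thesis
    by (rule filterlim_mono) (auto simp: at_le barrier_def)
qed

text \<open>The sign is integrated twice: \<open>barrier_sign\<close> fixes the sign of
  \<open>h\<close>, which fixes that of \<open>f'\<close> and hence of \<open>f\<close>. Both
  \<open>h\<close> and \<open>f\<close> tend to \<open>0\<close> at \<open>0\<close>.\<close>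

lemma sinc_vs_M:
  assumes k: "1 \<le> k" "k < 3" and q: "0 < q" and x: "0 < x" "x < pi / 2"
  shows M_less_sinc: "(\<And>c. 0 < c \<Longrightarrow> c < 1 \<Longrightarrow> barrier_sign k q c < 0) \<Longrightarrow> M k (cos x) q < sin x / x"
    and sinc_less_M: "(\<And>c. 0 < c \<Longrightarrow> c < 1 \<Longrightarrow> barrier_sign k q c > 0) \<Longrightarrow> sin x / x < M k (cos x) q"
proof -
  have cos: "0 < cos y" "cos y < 1" "0 < sin y" if "0 < y" "y < pi / 2" for y
    using that cos_monotone_0_pi[of 0 y] by (auto intro: cos_gt_zero sin_gt_zero)
  define h where "h y = barrier k q y - y" for y
  define f where "f y = ln (sin y / y) - ln (M k (cos y) q)" for y
  have h': "(h has_real_derivative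
      (1 - (cos y)\<^sup>2) * barrier_sign k q (cos y) / (barrier_den k q (cos y))\<^sup>2) (at y)"
    if "0 < y" "y < pi / 2" for y
    unfolding h_def using barrier_deriv k cos that by simp
  have f': "(f has_real_derivative
      barrier_den k q (cos y) * (- h y) / (y * sin y * barrier_num k q (cos y))) (at y)"
    if "0 < y" "y < pi / 2" for y
    unfolding f_def h_def using ln_sinc_minus_ln_M_deriv[OF k q that] by simp
  have h0: "(h \<longlongrightarrow> 0) (at_right 0)"
    unfolding h_def using barrier_tendsto_0 k by simp
  have f0: "(f \<longlongrightarrow> 0) (at_right 0)"
    unfolding f_def using ln_sinc_minus_ln_M_tendsto_0 k q by simp
  have den: "0 < barrier_den k q (cos y)" "0 < y * sin y * barrier_num k q (cos y)"
      "0 < 1 - (cos y)\<^sup>2"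
    if "0 < y" "y < pi / 2" for y
    using that cos[OF that] barrier_den_pos[of k "cos y" q] barrier_num_pos[of k "cos y" q] k
    by (auto simp: power_less_one_iff)
  have M: "0 < M k (cos x) q"
    using box_cox_M(1)[of k q "cos x"] cos[OF x] k q by (simp add: admissible_def)
  have u: "0 < sin x / x"
    using cos x by simp
  show "M k (cos x) q < sin x / x" if Z: "\<And>c. 0 < c \<Longrightarrow> c < 1 \<Longrightarrow> barrier_sign k q c < 0"
  proof -
    have h: "0 < - h y" if y: "0 < y" "y < pi / 2" for y
    proof (rule pos_of_tendsto_0_of_deriv_pos[OF _ y(1)])
      show "((\<lambda>y. - h y) \<longlongrightarrow> 0) (at_right 0)"
        using tendsto_minus[OF h0] by simp
    next
      fix z assume "0 < z" "z \<le> y"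
      then have z: "0 < z" "z < pi / 2"
        using y by auto
      show "\<exists>d. ((\<lambda>y. - h y) has_real_derivative d) (at z) \<and> 0 < d"
        using DERIV_minus[OF h'[OF z]] den(1,3)[OF z] Z[OF cos(1,2)[OF z]]
        by (intro exI conjI) (assumption, simp add: mult_less_0_iff divide_less_0_iff)
    qed
    have "0 < f x"
    proof (rule pos_of_tendsto_0_of_deriv_pos[OF f0 x(1)])
      fix z assume "0 < z" "z \<le> x"
      then have z: "0 < z" "z < pi / 2"
        using x by auto
      show "\<exists>d. (f has_real_derivative d) (at z) \<and> 0 < d"
        using f'[OF z] den(1,2)[OF z] h[OF z]
        by (intro exI conjI) (assumption, rule divide_pos_pos[OF mult_pos_pos])
    qed
    then show ?thesis
      using M u by (simp add: f_def)
  qed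
  show "sin x / x < M k (cos x) q" if Z: "\<And>c. 0 < c \<Longrightarrow> c < 1 \<Longrightarrow> barrier_sign k q c > 0"
  proof -
    have h: "0 < h y" if y: "0 < y" "y < pi / 2" for y
    proof (rule pos_of_tendsto_0_of_deriv_pos[OF h0 y(1)])
      fix z assume "0 < z" "z \<le> y"
      then have z: "0 < z" "z < pi / 2"
        using y by auto
      show "\<exists>d. (h has_real_derivative d) (at z) \<and> 0 < d"
        using h'[OF z] den(1,3)[OF z] Z[OF cos(1,2)[OF z]]
        by (intro exI conjI) (assumption, simp)
    qed
    have "0 < - f x"
    proof (rule pos_of_tendsto_0_of_deriv_pos[OF _ x(1)])
      show "((\<lambda>y. - f y) \<longlongrightarrow> 0) (at_right 0)"
        using tendsto_minus[OF f0] by simp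
    next
      fix z assume "0 < z" "z \<le> x"
      then have z: "0 < z" "z < pi / 2"
        using x by auto
      show "\<exists>d. ((\<lambda>y. - f y) has_real_derivative d) (at z) \<and> 0 < d"
        using DERIV_minus[OF f'[OF z]] den(1,2)[OF z] h[OF z]
        by (intro exI conjI) (assumption, simp add: mult_less_0_iff divide_less_0_iff)
    qed
    then show ?thesis
      using M u by (simp add: f_def)
  qed
qed

section \<open>The three extremal inequalities\<close>

lemma barrier_sign_exponent_1:
  assumes "0 < c"
  shows "barrier_sign k 1 c = (1 - c) * (k\<^sup>2 - 7 * k + 8 - (k - 1)\<^sup>2 * c)"
  using assms by (simp add: barrier_sign_def power2_eq_square algebra_simps)

text \<open>At \<open>k = 7 / 5\<close>, where the curve meets \<open>q = 1\<close>, the sign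
  function is the square \<open>4 / 25 * (1 - c)\<^sup>2\<close>.\<close>

lemma sinc_less_M_7_5_1:
  assumes "0 < x" "x < pi / 2"
  shows "sin x / x < M (7 / 5) (cos x) 1"
  using assms by (intro sinc_less_M)
    (auto simp: barrier_sign_exponent_1 power2_eq_square intro!: mult_pos_pos)

text \<open>\<open>36 / 25\<close> lies just above the smaller root of
  \<open>k\<^sup>2 - 7 * k + 8\<close>, so the second factor is negative, and still below
  \<open>pi\<^sup>2 / 4 - 1\<close>.\<close>

lemma M_36_25_1_less_sinc:
  assumes "0 < x" "x < pi / 2"
  shows "M (36 / 25) (cos x) 1 < sin x / x"
  using assms by (intro M_less_sinc)
    (auto simp: barrier_sign_exponent_1 power2_eq_square intro!: mult_pos_neg)

text \<open>The polynomial has a triple zero at \<open>1\<close>. Its derivative is \<open>y ^ 16 * I y\<close>, where \<open>I\<close> first decreases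
  and then increases to \<open>I 1 = 0\<close>, so that \<open>I\<close> changes sign only once.\<close>

lemma barrier_polynomial_pos:
  fixes y :: real
  assumes "0 < y" "y < 1"
  shows "0 < 17 + 850 * y ^ 17 - 980 * y ^ 18 + 158 * y ^ 35 - 45 * y ^ 52"
proof -
  define J where "J y = 17 + 850 * y ^ 17 - 980 * y ^ 18 + 158 * y ^ 35 - 45 * y ^ 52" for y :: real
  define I where "I y = 14450 - 17640 * y + 5530 * y ^ 18 - 2340 * y ^ 35" for y :: real
  have J': "(J has_real_derivative v ^ 16 * I v) (at v)" for v
  proof -
    have "v ^ 17 = v ^ 16 * v" "v ^ 34 = v ^ 16 * v ^ 18" "v ^ 51 = v ^ 16 * v ^ 35"
      by (simp_all flip: power_add power_Suc2)
    then show "(J has_real_derivative v ^ 16 * I v) (at v)"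
      unfolding J_def I_def by (auto intro!: derivative_eq_intros simp: algebra_simps)
  qed
  have I': "(I has_real_derivative 1260 * (1 - v ^ 17) * (65 * v ^ 17 - 14)) (at v)" for v
    unfolding I_def
    by (auto intro!: derivative_eq_intros simp: algebra_simps power_add[symmetric])
  show ?thesis
  proof (cases "0 \<le> I y")
    case True
    \<comment> \<open>To the right of the minimum \<open>I\<close> would be below
      \<open>I 1 = 0\<close>. So \<open>y\<close> is on the decreasing branch, \<open>I\<close> is
      nonnegative on \<open>[0, y]\<close>, and \<open>J\<close> grows from
      \<open>J 0 = 17\<close>.\<close>
    have below: "65 * y ^ 17 < 14"
    proof (rule ccontr)
      assume *: "\<not> 65 * y ^ 17 < 14"
      have "I y < I 1"
      proof (rule DERIV_pos_imp_increasing_open[OF assms(2)])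
        fix v assume v: "y < v" "v < 1"
        then have "y ^ 17 < v ^ 17" "v ^ 17 < 1"
          using assms by (auto intro!: power_strict_mono simp: power_less_one_iff)
        then show "\<exists>d. (I has_real_derivative d) (at v) \<and> 0 < d"
          using * I'[of v] by (intro exI conjI) auto
      qed (auto simp: I_def intro!: continuous_intros)
      then show False
        using True by (simp add: I_def)
    qed
    have "J 0 \<le> J y"
    proof (rule DERIV_nonneg_imp_nondecreasing[of 0 y J])
      fix v assume v: "0 \<le> v" "v \<le> y"
      have "I y \<le> I v"
      proof (rule DERIV_nonpos_imp_nonincreasing[OF v(2)])
        fix z assume z: "v \<le> z" "z \<le> y"
        then have "z ^ 17 \<le> y ^ 17" "z ^ 17 \<le> 1"
          using assms v by (auto intro!: power_mono power_le_one)
        then show "\<exists>d. (I has_real_derivative d) (at z) \<and> d \<le> 0"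
          using below I'[of z] by (intro exI conjI) (auto intro: mult_nonneg_nonpos)
      qed
      then have "0 \<le> v ^ 16 * I v"
        using True v by simp
      then show "\<exists>d. (J has_real_derivative d) (at v) \<and> 0 \<le> d"
        using J' by blast
    qed (use assms in simp)
    then show ?thesis
      by (simp add: J_def)
  next
    case False
    \<comment> \<open>Once negative, \<open>I\<close> stays negative up to \<open>1\<close>, so
      \<open>J\<close> decreases to \<open>J 1 = 0\<close>.\<close>
    have neg: "I v < 0" if v: "y \<le> v" "v < 1" for v
    proof (cases "65 * v ^ 17 < 14")
      case True
      have "I v \<le> I y"
      proof (rule DERIV_nonpos_imp_nonincreasing[OF v(1)])
        fix z assume z: "y \<le> z" "z \<le> v"
        then have "z ^ 17 \<le> v ^ 17" "z ^ 17 \<le> 1"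
          using assms v by (auto intro!: power_mono power_le_one)
        then show "\<exists>d. (I has_real_derivative d) (at z) \<and> d \<le> 0"
          using True I'[of z] by (intro exI conjI) (auto intro: mult_nonneg_nonpos)
      qed
      then show ?thesis
        using False by simp
    next
      case above: False
      have "I v < I 1"
      proof (rule DERIV_pos_imp_increasing_open[OF v(2)])
        fix z assume z: "v < z" "z < 1"
        then have "v ^ 17 < z ^ 17" "z ^ 17 < 1"
          using assms v by (auto intro!: power_strict_mono simp: power_less_one_iff)
        then show "\<exists>d. (I has_real_derivative d) (at z) \<and> 0 < d"
          using above I'[of z] by (intro exI conjI) auto
      qed (auto simp: I_def intro!: continuous_intros)
      then show ?thesis
        by (simp add: I_def)
    qed
    have "J 1 < J y"
    proof (rule DERIV_neg_imp_decreasing_open[OF assms(2)])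
      fix v assume v: "y < v" "v < 1"
      then have "v ^ 16 * I v < 0"
        using neg[of v] assms by (intro mult_pos_neg) auto
      then show "\<exists>d. (J has_real_derivative d) (at v) \<and> d < 0"
        using J' by blast
    qed (auto simp: J_def intro!: continuous_intros)
    then show ?thesis
      by (simp add: J_def)
  qed
qed

text \<open>These parameters lie on the curve. With \<open>c = w ^ 35\<close> the sign function is a
  negative multiple of the polynomial above at \<open>y = w\<^sup>2\<close>.\<close>

lemma barrier_sign_23_17_34_35:
  assumes "0 < c" "c < 1"
  shows "barrier_sign (23 / 17) (34 / 35) c < 0"
proof -
  define w where "w = c powr (1 / 35)" \<comment> \<open>turns \<open>barrier_sign\<close> into a polynomial\<close>
  have w: "0 < w" "w < 1"
    using assms powr_less_mono2[of "1 / 35" c 1] by (auto simp: w_def)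
  have c: "c = w ^ 35"
    using assms by (simp add: w_def powr_realpow[symmetric] powr_powr)
  \<comment> \<open>Treating \<open>w ^ 34\<close> as an atom keeps the identity of low degree in
    \<open>P\<close> and \<open>w\<close>.\<close>
  define P where "P = w ^ 34"
  have P: "0 < P" "c = P * w" "(w\<^sup>2) ^ 17 = P" "(w\<^sup>2) ^ 18 = P * w\<^sup>2"
      "(w\<^sup>2) ^ 35 = P\<^sup>2 * w\<^sup>2" "(w\<^sup>2) ^ 52 = P ^ 3 * w\<^sup>2"
    using w by (simp_all add: P_def c flip: power_mult power_add power_Suc2)
  have "barrier_sign (23 / 17) (34 / 35) c
      = - 4 / (1445 * w ^ 34) * (17 + 850 * (w\<^sup>2) ^ 17 - 980 * (w\<^sup>2) ^ 18
          + 158 * (w\<^sup>2) ^ 35 - 45 * (w\<^sup>2) ^ 52)"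
    unfolding P(3-6) using w P(1)
    by (simp add: barrier_sign_def Let_def w_def[symmetric])
      (simp add: P(2) P_def[symmetric] field_simps power2_eq_square power3_eq_cube)
  also have "\<dots> < 0"
    using w barrier_polynomial_pos[of "w\<^sup>2"] by (intro mult_neg_pos) (auto simp: power_less_one_iff)
  finally show ?thesis .
qed

lemma M_23_17_34_35_less_sinc:
  assumes "0 < x" "x < pi / 2"
  shows "M (23 / 17) (cos x) (34 / 35) < sin x / x"
  using assms by (intro M_less_sinc barrier_sign_23_17_34_35) auto

section \<open>Transfer to all parameters\<close>

text \<open>Move down the curve from \<open>q = 34 / 35\<close> to \<open>q\<close>, then leave it
  at fixed \<open>q\<close>: \<open>(3 - k) * q \<le> 8 / 5\<close> says that \<open>k * q\<close>
  is at least the curve exponent \<open>3 * q - 8 / 5\<close>.\<close>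

lemma lower_bound:
  assumes "admissible k q" "q \<le> 34 / 35" "(3 - k) * q \<le> 8 / 5" "0 < x" "x < pi / 2"
  shows "M k (cos x) q < sin x / x"
proof -
  have t: "0 < cos x" "cos x < 1" and u: "0 < sin x / x"
    using assms cos_monotone_0_pi[of 0 x]
    by (auto intro!: cos_gt_zero divide_pos_pos sin_gt_zero)
  have "box_cox (34 / 35) (cos x) / 3 < box_cox (3 * (34 / 35) - 8 / 5) (sin x / x)"
    using M_23_17_34_35_less_sinc[OF assms(4,5)] M_less_iff_box_cox[OF _ t u, of "23 / 17" "34 / 35"]
    by (simp add: admissible_def)
  then have "box_cox q (cos x) / 3 < box_cox (3 * q - 8 / 5) (sin x / x)"
    using assms t u by (intro curve_mean_mono_lower[of q "34 / 35"]) auto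
  also have "\<dots> \<le> box_cox (k * q) (sin x / x)"
    using assms u by (intro box_cox_mono_exponent) (auto simp: algebra_simps)
  finally show ?thesis
    using M_less_iff_box_cox[OF assms(1) t u] by simp
qed

text \<open>For \<open>q\<close> above \<open>34 / 35\<close>, start at \<open>(36 / 25, 1)\<close>,
  raise \<open>k\<close> at \<open>q = 1\<close>, then lower \<open>q\<close> at fixed
  \<open>k\<close> by the two-point mean with mass \<open>k / 3\<close>, compared with
  \<open>(sin x / x) powr k\<close>.\<close>

lemma lower_bound_large_k:
  assumes "36 / 25 \<le> k" "k < 3" "q \<le> 1" "0 < x" "x < pi / 2"
  shows "M k (cos x) q < sin x / x"
proof (cases "q \<le> 34 / 35")
  case True
  have "(3 - k) * q \<le> 8 / 5"
    using assms mult_mono[of "3 - k" "39 / 25" q 1] mult_nonneg_nonpos[of "3 - k" q]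
    by (cases "0 \<le> q") auto
  then show ?thesis
    using assms True by (intro lower_bound) (auto simp: admissible_def)
next
  case False
  have t: "0 < cos x" "cos x < 1" and u: "0 < sin x / x"
    using assms cos_monotone_0_pi[of 0 x]
    by (auto intro!: cos_gt_zero divide_pos_pos sin_gt_zero)
  have "box_cox 1 (cos x) / 3 < box_cox (36 / 25) (sin x / x)"
    using M_36_25_1_less_sinc[OF assms(4,5)] M_less_iff_box_cox[OF _ t u, of "36 / 25" 1]
    by (simp add: admissible_def)
  also have "\<dots> \<le> box_cox k (sin x / x)"
    using assms u by (intro box_cox_mono_exponent) auto
  finally have "k / 3 * box_cox 1 (cos x) < box_cox 1 ((sin x / x) powr k)"
    using assms u by (simp add: box_cox_powr field_simps)
  then have "k / 3 * box_cox q (cos x) < box_cox q ((sin x / x) powr k)"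
    using assms t u by (intro two_point_mean_mono[of q 1]) auto
  then show ?thesis
    using assms t u by (subst M_less_iff_box_cox) (auto simp: admissible_def box_cox_powr)
qed

text \<open>Move up the curve from \<open>(7 / 5, 1)\<close>, then leave it at fixed
  \<open>q\<close>, where \<open>k * q\<close> is at most the curve exponent.\<close>

lemma upper_bound:
  assumes "admissible k q" "1 \<le> q" "8 / 5 \<le> (3 - k) * q" "0 < x" "x < pi / 2"
  shows "sin x / x < M k (cos x) q"
proof -
  have t: "0 < cos x" "cos x < 1" and u: "0 < sin x / x"
    using assms cos_monotone_0_pi[of 0 x]
    by (auto intro!: cos_gt_zero divide_pos_pos sin_gt_zero)
  have "box_cox (3 * 1 - 8 / 5) (sin x / x) < box_cox 1 (cos x) / 3"
    using sinc_less_M_7_5_1[OF assms(4,5)] less_M_iff_box_cox[OF _ t u, of "7 / 5" 1]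
    by (simp add: admissible_def)
  then have *: "box_cox (3 * q - 8 / 5) (sin x / x) < box_cox q (cos x) / 3"
    using assms t u by (intro curve_mean_mono_upper[of 1 q]) auto
  have "box_cox (k * q) (sin x / x) \<le> box_cox (3 * q - 8 / 5) (sin x / x)"
    using assms u by (intro box_cox_mono_exponent) (auto simp: algebra_simps)
  also note *
  finally show ?thesis
    using less_M_iff_box_cox[OF assms(1) t u] by simp
qed

theorem theorem5:
  fixes x :: real
  assumes "0 < x" and "x < pi / 2"
  shows
   "(\<forall>k q. 3 < k \<and> admissible k q \<and> 8 / (5 * (3 - k)) \<le> q \<and> q \<le> 0
        \<longrightarrow> sin x / x > M k (cos x) q)
  \<and> (\<forall>k q1 q2. (35 * pi\<^sup>2 - 140) / 136 \<le> k \<and> k < 3 \<and> admissible k q1 \<and> admissible k q2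
        \<and> q2 \<ge> 8 / (5 * (3 - k)) \<and> q1 \<le> 1 \<longrightarrow> dbl k q1 q2 x)
  \<and> (\<forall>k q1 q2. pi\<^sup>2 / 4 - 1 \<le> k \<and> k < (35 * pi\<^sup>2 - 140) / 136
        \<and> admissible k q1 \<and> admissible k q2
        \<and> q2 \<ge> 8 / (5 * (3 - k))
        \<and> (q1 \<le> 34 / 35 \<or> ((pi\<^sup>2 / 4 - 1) / k \<le> q1 \<and> q1 \<le> 1)) \<longrightarrow> dbl k q1 q2 x)
  \<and> (\<forall>k q1 q2. 7 / 5 \<le> k \<and> k < pi\<^sup>2 / 4 - 1 \<and> admissible k q1 \<and> admissible k q2
        \<and> q2 \<ge> 8 / (5 * (3 - k)) \<and> q1 \<le> 34 / 35 \<longrightarrow> dbl k q1 q2 x)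
  \<and> (\<forall>k q1 q2. 23 / 17 \<le> k \<and> k < 7 / 5 \<and> admissible k q1 \<and> admissible k q2
        \<and> q2 \<ge> 1 \<and> q1 \<le> 34 / 35 \<longrightarrow> dbl k q1 q2 x)
  \<and> (\<forall>k q1 q2. 0 \<le> k \<and> k < 23 / 17 \<and> admissible k q1 \<and> admissible k q2
        \<and> q2 \<ge> 1 \<and> q1 \<le> 8 / (5 * (3 - k)) \<longrightarrow> dbl k q1 q2 x)
  \<and> (\<forall>k q1 q2. k < 0 \<and> admissible k q1 \<and> admissible k q2
        \<and> q2 \<ge> 1 \<and> 0 \<le> q1 \<and> q1 \<le> 8 / (5 * (3 - k)) \<longrightarrow> dbl k q1 q2 x)"
proof -
  note lower = lower_bound[OF _ _ _ assms] and lower1 = lower_bound_large_k[OF _ _ _ assms]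
    and upper = upper_bound[OF _ _ _ assms]
  \<comment> \<open>The bound is \<open>4 * (36 / 25 + 1)\<close>, which brings
    \<open>pi\<^sup>2 / 4 - 1\<close> up to \<open>36 / 25\<close>.\<close>
  have "976 / 100 \<le> pi\<^sup>2"
    using power_mono[of "3.14" pi 2] pi_approx by (simp add: power2_eq_square)
  then have pi: "36 / 25 \<le> pi\<^sup>2 / 4 - 1" "36 / 25 \<le> (35 * pi\<^sup>2 - 140) / 136"
    by auto
  have upper_large: "sin x / x < M k (cos x) q"
    if "7 / 5 \<le> k" "k < 3" "8 / (5 * (3 - k)) \<le> q" for k q
  proof -
    have "1 \<le> 8 / (5 * (3 - k))"
      using that by (simp add: field_simps)
    then have "1 \<le> q"
      using that(3) by (rule order_trans)
    then show ?thesis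
      using that by (intro upper) (auto simp: admissible_def field_simps)
  qed
  have upper_small: "sin x / x < M k (cos x) q" if "k < 7 / 5" "1 \<le> q" for k q
    using that mult_mono[of "8 / 5" "3 - k" 1 q] by (intro upper) (auto simp: admissible_def)
  \<comment> \<open>For \<open>q \<ge> 0\<close> the product is at most
    \<open>28 / 17 * (34 / 35) = 8 / 5\<close>; for negative \<open>q\<close> it is
    nonpositive.\<close>
  have lower_mid: "M k (cos x) q < sin x / x"
    if "23 / 17 \<le> k" "k < 3" "q \<le> 34 / 35" for k q
    using that mult_mono[of "3 - k" "28 / 17" q "34 / 35"] mult_nonneg_nonpos[of "3 - k" q]
    by (intro lower; cases "0 \<le> q") (auto simp: admissible_def)
  have lower_small: "M k (cos x) q < sin x / x"
    if "admissible k q" "k < 23 / 17" "q \<le> 8 / (5 * (3 - k))" for k q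
  proof -
    have "8 / (5 * (3 - k)) \<le> 34 / 35"
      using that by (simp add: field_simps)
    with that(3) have "q \<le> 34 / 35"
      by (rule order_trans)
    then show ?thesis
      using that by (intro lower) (auto simp: field_simps)
  qed
  \<comment> \<open>Since \<open>3 - k\<close> is negative, clearing the denominator reverses the
    bound on \<open>q\<close> into \<open>(3 - k) * q \<le> 8 / 5\<close>.\<close>
  have lower_neg: "M k (cos x) q < sin x / x"
    if "admissible k q" "3 < k" "8 / (5 * (3 - k)) \<le> q" "q \<le> 0" for k q
    using that by (intro lower) (auto simp: field_simps)
  have ii: "dbl k q1 q2 x"
    if "36 / 25 \<le> k" "k < 3" "8 / (5 * (3 - k)) \<le> q2" "q1 \<le> 1" for k q1 q2
    unfolding dbl_def using that upper_large[of k q2] lower1[of k q1] by simp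
  have iii: "dbl k q1 q2 x"
    if "7 / 5 \<le> k" "k < 3" "8 / (5 * (3 - k)) \<le> q2" "q1 \<le> 34 / 35" for k q1 q2
    unfolding dbl_def using that upper_large[of k q2] lower_mid[of k q1] by simp
  have v: "dbl k q1 q2 x" if "23 / 17 \<le> k" "k < 7 / 5" "1 \<le> q2" "q1 \<le> 34 / 35" for k q1 q2
    unfolding dbl_def using that upper_small[of k q2] lower_mid[of k q1] by simp
  have vi: "dbl k q1 q2 x"
    if "admissible k q1" "k < 23 / 17" "1 \<le> q2" "q1 \<le> 8 / (5 * (3 - k))" for k q1 q2
    unfolding dbl_def using that upper_small[of k q2] lower_small[of k q1] by simp
  have "(35 * pi\<^sup>2 - 140) / 136 < 3" "pi\<^sup>2 / 4 - 1 < 3"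
    using power_strict_mono[of pi "3.3" 2] pi_approx by (simp_all add: power2_eq_square)
  note pi = pi this
  show ?thesis
  proof (intro conjI allI impI; elim conjE)
    fix k q :: real
    assume "3 < k" "admissible k q" "8 / (5 * (3 - k)) \<le> q" "q \<le> 0"
    then show "M k (cos x) q < sin x / x"
      by (intro lower_neg)
  next
    fix k q1 q2 :: real
    assume "(35 * pi\<^sup>2 - 140) / 136 \<le> k" "k < 3" "8 / (5 * (3 - k)) \<le> q2" "q1 \<le> 1"
    then show "dbl k q1 q2 x"
      using pi by (intro ii) linarith+
  next
    fix k q1 q2 :: real
    assume k: "pi\<^sup>2 / 4 - 1 \<le> k" "k < (35 * pi\<^sup>2 - 140) / 136" and q2: "8 / (5 * (3 - k)) \<le> q2"
      and "q1 \<le> 34 / 35 \<or> (pi\<^sup>2 / 4 - 1) / k \<le> q1 \<and> q1 \<le> 1"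
    then have "q1 \<le> 1"
      by auto
    then show "dbl k q1 q2 x"
      using pi k q2 by (intro ii) linarith+
  next
    fix k q1 q2 :: real
    assume "7 / 5 \<le> k" "k < pi\<^sup>2 / 4 - 1" "8 / (5 * (3 - k)) \<le> q2" "q1 \<le> 34 / 35"
    then show "dbl k q1 q2 x"
      using pi by (intro iii) linarith+
  next
    fix k q1 q2 :: real
    assume "23 / 17 \<le> k" "k < 7 / 5" "1 \<le> q2" "q1 \<le> 34 / 35"
    then show "dbl k q1 q2 x"
      by (intro v)
  next
    fix k q1 q2 :: real
    assume "k < 23 / 17" "admissible k q1" "1 \<le> q2" "q1 \<le> 8 / (5 * (3 - k))"
    then show "dbl k q1 q2 x"
      by (intro vi)
  next
    fix k q1 q2 :: real
    assume "k < 0" "admissible k q1" "1 \<le> q2" "q1 \<le> 8 / (5 * (3 - k))"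
    then show "dbl k q1 q2 x"
      by (intro vi) auto
  qed
qed

end
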